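(* Let $n$ be a nonnegative integer. There is an irreducible cubefree binary word of length $n$ if and only if $n \in \{10, 14, 18, 19, 20\} \cup \{m \mid m \geq 22\}$.
   Context: Words are finite strings over the binary alphabet $\{0,1\}$. A factor of a word is a contiguous subword. A cube is a word of the form $XXX$ with $X$ a nonempty word; a word is cubefree if none of its factors is a cube. A letter of a word is interior if it is neither the first nor the last letter of the word. An irreducible cubefree word is a cubefree word of length at least $3$ such that removing any one of its interior letters yields a word containing a cube as a factor. *)

theory Defs
  imports Main "HOL-Library.Sublist"
begin

text \<open>
  Binary words are lists over \<^typ>\<open>bool\<close> (\<^const>\<open>False\<close> for 0, \<^const>\<open>True\<close> for 1).
  In \<open>HOL-Library.Sublist\<close>, \<^const>\<open>sublist\<close> is the contiguous factor relation
  (the scattered one is \<^const>\<open>subseq\<close>).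
\<close>

type_synonym word = "bool list"

definition cube :: "word \<Rightarrow> bool" where
  "cube w \<longleftrightarrow> (\<exists>x. x \<noteq> [] \<and> w = x @ x @ x)"

definition cubefree :: "word \<Rightarrow> bool" where
  "cubefree w \<longleftrightarrow> (\<forall>u. sublist u w \<longrightarrow> \<not> cube u)"

text \<open>Positions count from 0, as for \<^const>\<open>nth\<close>.\<close>

definition remove_letter :: "nat \<Rightarrow> word \<Rightarrow> word" where
  "remove_letter i w = take i w @ drop (Suc i) w"

definition interior_position :: "nat \<Rightarrow> word \<Rightarrow> bool" where
  "interior_position i w \<longleftrightarrow> 0 < i \<and> Suc i < length w"

definition irreducible_cubefree :: "word \<Rightarrow> bool" where
  "irreducible_cubefree w \<longleftrightarrow>
     cubefree w \<and> 3 \<le> length w \<and>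
     (\<forall>i. interior_position i w \<longrightarrow> (\<exists>u. sublist u (remove_letter i w) \<and> cube u))"

end

theory Submission
  imports Defs
begin

text \<open>
  The excluded lengths are ruled out by enumerating the cubefree words. For the other direction,
  a 28-uniform morphism \<open>h\<close> and words \<open>w\<close> of the lengths 22 to 49 are used such that \<open>h v w\<close> is
  irreducible and cubefree whenever \<open>v\<close>, followed by one more letter depending on \<open>w\<close>, is cubefree.
  The property that the removal of any interior letter creates a cube passes from two words
  overlapping in at least two letters to their union, so it suffices to check it for single blocks.
  A cube with a short period in \<open>h v w\<close> is visible in three consecutive blocks; a cube with a long
  period contains a marker that occurs only at the borders between blocks, so that 28 divides the
  period and sampling every 28th letter yields a cube in \<open>v\<close>. Since \<open>h\<close> preserves cubefreeness,
  cubefree words \<open>v\<close> of all lengths exist.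
\<close>

section \<open>Cubes at the head of a word\<close>

text \<open>A cube is encoded as one comparison of the word with its shift by \<open>p\<close>. For
  \<open>p = 0\<close> this is trivially true, hence the side conditions
  \<open>0 < p\<close>.\<close>

definition cube_prefix :: "nat \<Rightarrow> word \<Rightarrow> bool" where
  "cube_prefix p w \<longleftrightarrow> 3 * p \<le> length w \<and> take (2 * p) w = take (2 * p) (drop p w)"

lemma cube_prefix_iff: "cube_prefix p w \<longleftrightarrow> (\<exists>x z. length x = p \<and> w = x @ x @ x @ z)"
proof
  assume h: "cube_prefix p w"
  let ?x = "take p w"
  have eq: "take p w @ take p (drop p w) = take p (drop p w) @ take p (drop p (drop p w))"
    using h by (simp add: cube_prefix_def mult_2 take_add)
  have len: "length w \<ge> 3 * p" using h by (simp add: cube_prefix_def)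
  have 1: "take p (drop p w) = ?x" and 2: "take p (drop p (drop p w)) = take p (drop p w)"
    using eq len by (auto simp: append_eq_append_conv)
  have "w = take p w @ take p (drop p w) @ take p (drop p (drop p w)) @ drop p (drop p (drop p w))"
    by (metis append_take_drop_id)
  then have "w = ?x @ ?x @ ?x @ drop p (drop p (drop p w))"
    using 1 2 by simp
  moreover have "length ?x = p" using len by simp
  ultimately show "\<exists>x z. length x = p \<and> w = x @ x @ x @ z" by blast
qed (auto simp: cube_prefix_def)

lemma cube_prefix_nth:
  "cube_prefix p w \<longleftrightarrow> 3 * p \<le> length w \<and> (\<forall>j<2 * p. w ! j = w ! (p + j))"
  by (auto simp: cube_prefix_def list_eq_iff_nth_eq)

lemma cube_prefix_take:
  "cube_prefix p (w @ z) \<Longrightarrow> 3 * p \<le> length w \<Longrightarrow> cube_prefix p w"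
  by (auto simp: cube_prefix_def)

lemma cubefree_iff: "cubefree w \<longleftrightarrow> (\<forall>i p. 0 < p \<longrightarrow> \<not> cube_prefix p (drop i w))"
proof
  assume h: "cubefree w"
  show "\<forall>i p. 0 < p \<longrightarrow> \<not> cube_prefix p (drop i w)"
  proof (intro allI impI notI)
    fix i p :: nat
    assume "0 < p" "cube_prefix p (drop i w)"
    then obtain x z where x: "x \<noteq> []" "drop i w = (x @ x @ x) @ z"
      by (auto simp: cube_prefix_iff)
    then have "w = take i w @ (x @ x @ x) @ z" by (metis append_take_drop_id)
    then have "sublist (x @ x @ x) w" by (metis sublist_appendI)
    with h x(1) show False by (auto simp: cubefree_def cube_def)
  qed
next
  assume h: "\<forall>i p. 0 < p \<longrightarrow> \<not> cube_prefix p (drop i w)"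
  show "cubefree w"
    unfolding cubefree_def cube_def
  proof (intro allI impI notI)
    fix u
    assume "sublist u w" "\<exists>x. x \<noteq> [] \<and> u = x @ x @ x"
    then obtain a b x where "x \<noteq> []" "w = a @ (x @ x @ x) @ b"
      by (auto simp: sublist_def)
    then have "0 < length x" "drop (length a) w = x @ x @ x @ b" by auto
    with h show False by (metis cube_prefix_iff)
  qed
qed

lemma cubefree_nth:
  "cubefree w \<longleftrightarrow>
    (\<forall>i p. 0 < p \<longrightarrow> i + 3 * p \<le> length w \<longrightarrow> (\<exists>j<2 * p. w ! (i + j) \<noteq> w ! (i + p + j)))"
proof -
  have "cube_prefix p (drop i w) \<longleftrightarrow> i + 3 * p \<le> length w \<and> (\<forall>j<2 * p. w ! (i + j) = w ! (i + p + j))"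
    if "0 < p" for i p
    using that by (cases "i \<le> length w") (auto simp: cube_prefix_nth add.assoc)
  then show ?thesis unfolding cubefree_iff by blast
qed

lemma cubefree_append: "cubefree (v @ w) \<Longrightarrow> cubefree v" "cubefree (v @ w) \<Longrightarrow> cubefree w"
  by (auto simp: cubefree_def sublist_def) (metis append.assoc)+

lemma cubefree_map_Not: "cubefree (map Not w) \<longleftrightarrow> cubefree w"
proof -
  have "map Not w ! (i + j) \<noteq> map Not w ! (i + p + j) \<longleftrightarrow> w ! (i + j) \<noteq> w ! (i + p + j)"
    if "i + 3 * p \<le> length w" "j < 2 * p" for i p j
    using that by simp
  then show ?thesis unfolding cubefree_nth length_map by blast
qed

section \<open>Decision procedures\<close>

fun agree :: "nat \<Rightarrow> word \<Rightarrow> word \<Rightarrow> bool" where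
  "agree 0 xs ys = True"
| "agree (Suc n) (x # xs) (y # ys) = (x = y \<and> agree n xs ys)"
| "agree (Suc n) xs ys = False"

text \<open>In \<open>find_period f n w t\<close>, the word \<open>t\<close> is \<open>w\<close> without its first \<open>n div 2 - 1\<close> letters
  and \<open>f\<close> counts the periods left to try.\<close>

fun find_period :: "nat \<Rightarrow> nat \<Rightarrow> word \<Rightarrow> word \<Rightarrow> bool" where
  "find_period (Suc f) n w (x # t) = (agree n w t \<or> find_period f (Suc (Suc n)) w t)"
| "find_period f n w t = False"

definition starts_cube :: "nat \<Rightarrow> word \<Rightarrow> bool" where
  "starts_cube c w = find_period c (Suc (Suc 0)) w w"

lemma agree_iff: "agree n xs ys \<longleftrightarrow> n \<le> length xs \<and> n \<le> length ys \<and> take n xs = take n ys"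
  by (induction n xs ys rule: agree.induct) auto

lemma find_period_iff:
  "find_period f (2 * Suc j) w (drop j w) \<longleftrightarrow> (\<exists>p. j < p \<and> p \<le> j + f \<and> cube_prefix p w)"
proof (induction f arbitrary: j)
  case (Suc f)
  show ?case
  proof (cases "drop j w")
    case Nil
    then show ?thesis by (auto simp: cube_prefix_def)
  next
    case (Cons x t)
    have t: "t = drop (Suc j) w" by (metis Cons drop_Suc list.sel(3) tl_drop)
    have "find_period (Suc f) (2 * Suc j) w (drop j w) \<longleftrightarrow>
        agree (2 * Suc j) w t \<or> find_period f (2 * Suc (Suc j)) w (drop (Suc j) w)"
      using Cons t by simp
    \<comment> \<open>\<open>agree\<close> demands \<open>2 * Suc j\<close> letters in
      \<open>t\<close> as well, which leaves room for the third copy of the period.\<close>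
    also have "agree (2 * Suc j) w t \<longleftrightarrow> cube_prefix (Suc j) w"
      unfolding t agree_iff cube_prefix_def by auto
    also have "cube_prefix (Suc j) w \<or> find_period f (2 * Suc (Suc j)) w (drop (Suc j) w) \<longleftrightarrow>
        (\<exists>p. j < p \<and> p \<le> j + Suc f \<and> cube_prefix p w)"
    proof -
      have "j < p \<and> p \<le> j + Suc f \<and> cube_prefix p w \<longleftrightarrow>
          p = Suc j \<and> cube_prefix (Suc j) w \<or> Suc j < p \<and> p \<le> Suc j + f \<and> cube_prefix p w" for p
        by (cases "p = Suc j") auto
      then show ?thesis unfolding Suc.IH by (simp add: ex_disj_distrib)
    qed
    finally show ?thesis .
  qed
qed auto

lemma starts_cube_iff: "starts_cube c w \<longleftrightarrow> (\<exists>p. 0 < p \<and> p \<le> c \<and> cube_prefix p w)"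
  using find_period_iff[of c 0 w] by (simp add: starts_cube_def numeral_2_eq_2)

lemma not_cubefree_if_starts_cube: "starts_cube c w \<Longrightarrow> \<not> cubefree (a @ w)"
  unfolding starts_cube_iff cubefree_iff by (metis append_eq_conv_conj)

text \<open>No period above \<open>c\<close> fits three times into fewer than
  \<open>3 * c + 3\<close> letters, so the bounded search is complete. A positive answer is
  conclusive for every \<open>c\<close>.\<close>

lemma cubefree_Cons_iff:
  assumes "length w < 3 * c + 2"
  shows "cubefree (x # w) \<longleftrightarrow> \<not> starts_cube c (x # w) \<and> cubefree w"
proof -
  have "p \<le> c" if "cube_prefix p (x # w)" for p
    using that assms by (simp add: cube_prefix_def)
  then have "starts_cube c (x # w) \<longleftrightarrow> (\<exists>p>0. cube_prefix p (x # w))"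
    unfolding starts_cube_iff by blast
  moreover
  have "(\<forall>i. P (drop i (x # w))) \<longleftrightarrow> P (x # w) \<and> (\<forall>i. P (drop i w))" for P
    by (metis drop0 drop_Suc_Cons not0_implies_Suc)
  note this[of "\<lambda>u. \<not> (\<exists>p>0. cube_prefix p u)"]
  moreover have "cubefree u \<longleftrightarrow> (\<forall>i. \<not> (\<exists>p>0. cube_prefix p (drop i u)))" for u
    unfolding cubefree_iff by blast
  ultimately show ?thesis by simp
qed

fun check_cubefree :: "nat \<Rightarrow> word \<Rightarrow> bool" where
  "check_cubefree c [] = True"
| "check_cubefree c (x # w) = (\<not> starts_cube c (x # w) \<and> check_cubefree c w)"

lemma cubefree_if_check_cubefree:
  "check_cubefree c w \<Longrightarrow> length w < 3 * c + 3 \<Longrightarrow> cubefree w"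
proof (induction w)
  case Nil
  then show ?case by (simp add: cubefree_iff cube_prefix_def)
next
  case (Cons x w)
  then show ?case using cubefree_Cons_iff[of w c x] by simp
qed

section \<open>Rigid words\<close>

text \<open>The removal condition is separated from cubefreeness so that it can be glued along
  overlaps.\<close>

definition rigid :: "word \<Rightarrow> bool" where
  "rigid w \<longleftrightarrow> (\<forall>a c b. w = a @ c # b \<longrightarrow> a \<noteq> [] \<longrightarrow> b \<noteq> [] \<longrightarrow> \<not> cubefree (a @ b))"

lemma irreducible_cubefree_iff:
  "irreducible_cubefree w \<longleftrightarrow> cubefree w \<and> 3 \<le> length w \<and> rigid w"
proof -
  have "rigid w \<longleftrightarrow> (\<forall>i. interior_position i w \<longrightarrow> \<not> cubefree (remove_letter i w))"
    unfolding rigid_def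
  proof safe
    fix i
    assume h: "\<forall>a c b. w = a @ c # b \<longrightarrow> a \<noteq> [] \<longrightarrow> b \<noteq> [] \<longrightarrow> \<not> cubefree (a @ b)"
      and i: "interior_position i w" and c: "cubefree (remove_letter i w)"
    have "w = take i w @ w ! i # drop (Suc i) w" "take i w \<noteq> []" "drop (Suc i) w \<noteq> []"
      using i by (auto simp: interior_position_def id_take_nth_drop)
    with h c show False unfolding remove_letter_def by blast
  next
    fix a c b
    assume h: "\<forall>i. interior_position i (a @ c # b) \<longrightarrow> \<not> cubefree (remove_letter i (a @ c # b))"
      and ab: "a \<noteq> []" "b \<noteq> []" "cubefree (a @ b)"
    have "interior_position (length a) (a @ c # b)" "remove_letter (length a) (a @ c # b) = a @ b"
      using ab by (auto simp: interior_position_def remove_letter_def)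
    with h ab show False by metis
  qed
  then show ?thesis unfolding irreducible_cubefree_def cubefree_def by blast
qed

text \<open>Up to the first letter of \<open>y\<close>, an interior letter is interior in
  \<open>x @ y\<close>; from the second on, it is interior in \<open>y @ z\<close>. The cube created
  there survives in the larger word.\<close>

lemma rigid_glue:
  assumes "rigid (x @ y)" "rigid (y @ z)" "2 \<le> length y"
  shows "rigid (x @ y @ z)"
  unfolding rigid_def
proof (intro allI impI)
  fix a c b
  assume eq: "x @ y @ z = a @ c # b" and ne: "a \<noteq> []" "b \<noteq> []"
  show "\<not> cubefree (a @ b)"
  proof (cases "length a \<le> length x")
    case True
    have "Suc (length a) < length (x @ y)" using True assms(3) by simp
    define b' where "b' = drop (Suc (length a)) (x @ y)"
    have len: "Suc (length a) < length (x @ y)" by fact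
    have "take (length a) (x @ y) = take (length a) ((x @ y) @ z)"
      using len by (simp del: append_assoc)
    moreover have "(x @ y) ! length a = ((x @ y) @ z) ! length a"
      using len by (simp add: nth_append del: append_assoc)
    ultimately have 1: "take (length a) (x @ y) = a" "(x @ y) ! length a = c"
      using eq by simp_all
    have 2: "x @ y = a @ c # b'"
      using id_take_nth_drop[of "length a" "x @ y"] len unfolding 1 b'_def by simp
    have "b = drop (Suc (length a)) ((x @ y) @ z)" using eq by simp
    then have 3: "b = b' @ z" using len unfolding b'_def by (simp del: append_assoc)
    have b': "b' \<noteq> []" "x @ y = a @ c # b'" "b = b' @ z"
      using 2 3 len by (auto simp: b'_def)
    with assms(1) ne have "\<not> cubefree (a @ b')" unfolding rigid_def by blast
    with b'(3) show ?thesis using cubefree_append(1) by (metis append.assoc)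
  next
    case False
    define a' where "a' = drop (length x) a"
    have a: "a = x @ a'" "a' \<noteq> []"
      using False eq unfolding a'_def
      by (auto simp: append_eq_append_conv2)
    with eq have "y @ z = a' @ c # b" by simp
    with assms(2) ne a have "\<not> cubefree (a' @ b)" unfolding rigid_def by blast
    with a show ?thesis using cubefree_append(2) by auto
  qed
qed

text \<open>A zipper: \<open>ra\<close> is the reversed part before the removed letter. Only cubes
  starting in that part are sought, since a cube inside \<open>b\<close> is also a factor of the
  word before the removal.\<close>

fun makes_cube :: "nat \<Rightarrow> word \<Rightarrow> word \<Rightarrow> bool" where
  "makes_cube c (x # ra) b = (starts_cube c (x # b) \<or> makes_cube c ra (x # b))"
| "makes_cube c [] b = False"

lemma not_cubefree_if_makes_cube: "makes_cube c ra b \<Longrightarrow> \<not> cubefree (rev ra @ b)"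
  by (induction c ra b rule: makes_cube.induct) (auto dest: not_cubefree_if_starts_cube)

lemma cubefree_if_not_makes_cube:
  "\<not> makes_cube c ra b \<Longrightarrow> cubefree b \<Longrightarrow> length ra + length b < 3 * c + 3 \<Longrightarrow> cubefree (rev ra @ b)"
proof (induction c ra b rule: makes_cube.induct)
  case (1 c x ra b)
  then show ?case using cubefree_Cons_iff[of b c x] by simp
qed simp

fun check_rigid :: "nat \<Rightarrow> word \<Rightarrow> word \<Rightarrow> bool" where
  "check_rigid c ra (x # b) = ((ra = [] \<or> b = [] \<or> makes_cube c ra b) \<and> check_rigid c (x # ra) b)"
| "check_rigid c ra [] = True"

lemma check_rigid_sound:
  assumes "check_rigid c ra w" "w = a @ x # b" "rev ra @ a \<noteq> []" "b \<noteq> []"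
  shows "\<not> cubefree (rev ra @ a @ b)"
  using assms
proof (induction a arbitrary: ra w)
  case Nil
  then show ?case using not_cubefree_if_makes_cube by auto
next
  case (Cons y a)
  show ?case using Cons.IH[of "y # ra" "a @ x # b"] Cons.prems by auto
qed

lemma rigid_if_check_rigid: "check_rigid c [] w \<Longrightarrow> rigid w"
  unfolding rigid_def using check_rigid_sound by force

section \<open>The excluded lengths\<close>

fun has_removable :: "nat \<Rightarrow> word \<Rightarrow> word \<Rightarrow> bool" where
  "has_removable c ra [] = False"
| "has_removable c ra (x # b) =
    (ra \<noteq> [] \<and> b \<noteq> [] \<and> \<not> makes_cube c ra b \<or> has_removable c (x # ra) b)"

text \<open>Here the absence of cubes has to be certified, so the length must be bounded in terms of
  \<open>c\<close>.\<close>

lemma not_rigid_if_has_removable: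
  assumes "has_removable c ra b" "cubefree (rev ra @ b)" "length ra + length b < 3 * c + 3"
  shows "\<not> rigid (rev ra @ b)"
  using assms
proof (induction c ra b rule: has_removable.induct)
  case (2 c ra x b)
  show ?case
  proof (cases "ra \<noteq> [] \<and> b \<noteq> [] \<and> \<not> makes_cube c ra b")
    case True
    have "cubefree b" using 2 cubefree_append(2)[of "rev ra @ [x]" b] by simp
    then have "cubefree (rev ra @ b)" using True 2 by (auto intro: cubefree_if_not_makes_cube)
    with True show ?thesis unfolding rigid_def by auto
  next
    case False
    then show ?thesis using 2 by auto
  qed
qed simp

text \<open>The \<open>k\<close>-th flag tells whether the cubefree words obtained by prepending \<open>k + 1\<close> letters to \<open>w\<close>
  are to be tested.\<close>

fun check_all :: "nat \<Rightarrow> bool list \<Rightarrow> word \<Rightarrow> bool" where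
  "check_all c [] w = True"
| "check_all c (f # fs) w =
    list_all (\<lambda>x. starts_cube c (x # w) \<or> (if f then has_removable c [] (x # w) else True) \<and>
                 check_all c fs (x # w)) [False, True]"

text \<open>Suffixes of cubefree words are cubefree, so the leftward search, pruned at heads of
  cubes, still reaches every cubefree word.\<close>

lemma check_all_sound:
  assumes "check_all c fs w" "k < length fs" "fs ! k" "length v = Suc k" "cubefree (v @ w)"
  shows "has_removable c [] (v @ w)"
  using assms
proof (induction c fs w arbitrary: k v rule: check_all.induct)
  case (2 c f fs w)
  obtain v' x where v: "v = v' @ [x]" using "2.prems"(4) by (metis length_Suc_conv_rev)
  have "cubefree (x # w)" using "2.prems"(5) v cubefree_append(2)[of v' "x # w"] by simp
  then have "\<not> starts_cube c (x # w)" using not_cubefree_if_starts_cube[of c "x # w" "[]"] by auto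
  then have *: "f \<Longrightarrow> has_removable c [] (x # w)" "check_all c fs (x # w)"
    using "2.prems"(1) by (cases x; auto split: if_splits)+
  show ?case
  proof (cases k)
    case 0
    then show ?thesis using * v "2.prems" by auto
  next
    case (Suc k')
    have "has_removable c [] (v' @ x # w)"
      using "2.IH"[of x k' v'] *(2) v "2.prems" Suc by (cases x) auto
    then show ?thesis using v by simp
  qed
qed simp

abbreviation (input) "T \<equiv> True"
abbreviation (input) "F \<equiv> False"

text \<open>The flag at index \<open>k\<close> belongs to length \<open>k + 1\<close>. Period 7 is
  the largest that fits three times into 21 letters.\<close>

lemma check_all_21:
  "check_all 7 (map (\<lambda>n. n \<in> set [3, 4, 5, 6, 7, 8, 9, 11, 12, 13, 15, 16, 17, 21]) [1..<22]) []"
  by code_simp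

lemma no_irreducible_cubefree:
  assumes "length w \<in> {3, 4, 5, 6, 7, 8, 9, 11, 12, 13, 15, 16, 17, 21}"
  shows "\<not> irreducible_cubefree w"
proof
  assume irr: "irreducible_cubefree w"
  have len: "0 < length w" "length w \<le> 21" using assms by auto
  have "length w \<in> set [3, 4, 5, 6, 7, 8, 9, 11, 12, 13, 15, 16, 17, 21]"
    using assms by simp
  with len have "has_removable 7 [] w"
    using check_all_sound[OF check_all_21, of "length w - 1" w] irr
    by (simp add: irreducible_cubefree_iff del: upt_Suc list.set)
  with len have "\<not> rigid w" using not_rigid_if_has_removable[of 7 "[]" w] irr
    by (simp add: irreducible_cubefree_iff)
  with irr show False by (simp add: irreducible_cubefree_iff)
qed

section \<open>A uniform morphism\<close>

lemma agree_drop_iff: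
  "agree (length m) m (drop i w) \<longleftrightarrow>
    i + length m \<le> length w \<and> (\<forall>l<length m. m ! l = w ! (i + l)) \<or> m = []"
proof (cases "i + length m \<le> length w")
  case True
  then have "m = take (length m) (drop i w) \<longleftrightarrow> (\<forall>l<length m. m ! l = w ! (i + l))"
    by (subst list_eq_iff_nth_eq) simp
  then show ?thesis using True by (auto simp: agree_iff)
next
  case False
  then show ?thesis by (cases m) (auto simp: agree_iff)
qed

text \<open>The period \<open>p\<close> of a long cube is a multiple of \<open>q\<close>, because the cube contains the marker \<open>m\<close>
  together with its translate by \<open>p\<close>; so the letters at the positions \<open>d\<close> modulo \<open>q\<close> inherit a cube
  with period \<open>p div q\<close>.\<close>

lemma cubefree_by_decimation:
  fixes q r d c :: nat and m V W :: word
  assumes short: "\<And>i. \<not> starts_cube c (drop i W)"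
    and aligned: "\<And>i. agree (length m) m (drop i W) \<Longrightarrow> i mod q = r"
    and dense: "\<And>i p. c < p \<Longrightarrow> i + 3 * p \<le> length W \<Longrightarrow>
      \<exists>j\<ge>i. j + length m \<le> i + 2 * p \<and> agree (length m) m (drop j W)"
    and V: "\<And>t. t < length V \<longleftrightarrow> q * t + d < length W"
      "\<And>t. t < length V \<Longrightarrow> V ! t = W ! (q * t + d)"
    and "d < q" "cubefree V"
  shows "cubefree W"
  unfolding cubefree_nth
proof (intro allI impI, rule ccontr)
  fix i p :: nat
  assume p: "0 < p" and ip: "i + 3 * p \<le> length W"
    and "\<not> (\<exists>j<2 * p. W ! (i + j) \<noteq> W ! (i + p + j))"
  then have per: "W ! (i + j) = W ! (i + p + j)" if "j < 2 * p" for j using that by blast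
  have per': "W ! j = W ! (j + p)" if "i \<le> j" "j < i + 2 * p" for j
    using per[of "j - i"] that by (simp add: add.commute add.left_commute)
  have "cube_prefix p (drop i W)"
    using p ip per by (auto simp: cube_prefix_nth add.assoc)
  then have "c < p" using short[of i] p unfolding starts_cube_iff by (meson not_less)
  from dense[OF this ip] obtain j
    where j: "i \<le> j" "j + length m \<le> i + 2 * p" "agree (length m) m (drop j W)" by blast
  \<comment> \<open>The marker at \<open>j\<close> lies within the first two periods, so its
    translate by \<open>p\<close> is still inside the cube.\<close>
  have "agree (length m) m (drop (j + p) W)"
  proof (cases "m = []")
    case False
    have "W ! (j + l) = W ! (j + p + l)" if "l < length m" for l
      using per'[of "j + l"] j that by (simp add: add.commute add.left_commute)
    then show ?thesis using j ip False unfolding agree_drop_iff by auto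
  qed simp
  then have "(j + p) mod q = j mod q" using aligned j(3) by simp
  then have "q dvd p" by (metis add_diff_cancel_left' le_add1 mod_eq_dvd_iff_nat)
  then obtain k where k: "p = q * k" by blast
  with p have kpos: "0 < k" by simp
  \<comment> \<open>\<open>q * t + d\<close> is the first sampled position not before
    \<open>i\<close>: the quotient is \<open>(i - d) / q\<close> rounded up.\<close>
  define t where "t = (i + (q - 1 - d)) div q"
  have "q * t + (i + (q - 1 - d)) mod q = i + (q - 1 - d)"
    unfolding t_def by simp
  moreover have "(i + (q - 1 - d)) mod q < q" using \<open>d < q\<close> by simp
  ultimately have t: "i \<le> q * t + d" "q * t + d < i + q" using \<open>d < q\<close> by linarith+
  have step: "q * (s + k) + d = (q * s + d) + p" for s by (simp add: k algebra_simps)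
  \<comment> \<open>With \<open>n = 2 * k\<close> this places samples in the first two periods, with
    \<open>n = 3 * k\<close> in the whole cube.\<close>
  have bound: "q * (t + s) + d < i + q * n" if "s < n" for s n
  proof -
    have "q * (s + 1) \<le> q * n" using that by (intro mult_le_mono2) simp
    then show ?thesis using t(2) by (simp add: algebra_simps)
  qed
  have "q * (t + (3 * k - 1)) + d < i + q * (3 * k)" using kpos by (intro bound) simp
  also have "\<dots> \<le> length W" using ip k by (simp add: algebra_simps)
  finally have "t + (3 * k - 1) < length V" using V(1) by blast
  then have tk: "t + 3 * k \<le> length V" using kpos by linarith
  have "V ! (t + s) = V ! (t + k + s)" if "s < 2 * k" for s
  proof -
    have "q * (t + s) + d < i + 2 * p" using bound[OF that] by (simp add: k algebra_simps)
    moreover have "i \<le> q * (t + s) + d" using t(1) by (simp add: algebra_simps)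
    ultimately have "W ! (q * (t + s) + d) = W ! (q * (t + s + k) + d)"
      unfolding step by (rule per'[rotated])
    then show ?thesis using V(2)[of "t + s"] V(2)[of "t + k + s"] that tk
      by (simp add: ac_simps)
  qed
  with tk kpos \<open>cubefree V\<close> show False unfolding cubefree_nth by blast
qed

section \<open>Blocks, marker and tails\<close>

text \<open>The letter with index 24 of \<open>block c\<close> is \<open>c\<close>.\<close>

definition block :: "bool \<Rightarrow> word" where
  "block c =
    (if c then [F,T,F,F,T,F,T,T,F,F,T,F,T,F,F,T,T,F,T,F,T,T,F,F,T,F,T,T]
     else [F,T,F,F,T,F,T,T,F,T,F,F,T,F,T,F,F,T,T,F,F,T,F,T,F,F,T,T])"

definition morphism :: "word \<Rightarrow> word" where
  "morphism v = concat (map block v)"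

text \<open>Both blocks and all words in \<open>tails\<close> start with \<open>head\<close>, and both blocks end in \<open>T\<close>; hence
  \<open>marker\<close> occurs at every border.\<close>

definition head :: word where
  "head = [F,T,F,F,T,F,T,T]"

definition marker :: word where
  "marker = [T,F,T,F,F,T,F,T,T]"

text \<open>Found by a backtracking search.\<close>

definition tails :: "word list" where
  "tails = [
    [F,T,F,F,T,F,T,T,F,T,T,F,F,T,F,F,T,F,T,T,F,T],
    [F,T,F,F,T,F,T,T,F,F,T,F,T,F,F,T,T,F,T,F,F,T,F],
    [F,T,F,F,T,F,T,T,F,T,F,T,T,F,F,T,T,F,T,F,T,T,F,T],
    [F,T,F,F,T,F,T,T,F,F,T,F,T,F,F,T,T,F,F,T,F,T,F,F,T],
    [F,T,F,F,T,F,T,T,F,F,T,F,T,F,F,T,T,F,F,T,F,T,F,F,T,F],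
    [F,T,F,F,T,F,T,T,F,T,F,F,T,F,T,F,F,T,T,F,F,T,F,T,F,F,T],
    [F,T,F,F,T,F,T,T,F,T,F,F,T,F,T,F,F,T,T,F,F,T,F,T,F,F,T,F],
    [F,T,F,F,T,F,T,T,F,T,F,F,T,T,F,T,F,T,T,F,F,T,T,F,T,F,T,T,F],
    [F,T,F,F,T,F,T,T,F,T,F,F,T,T,F,T,F,T,T,F,F,T,T,F,T,F,T,T,F,T],
    [F,T,F,F,T,F,T,T,F,T,F,F,T,T,F,T,F,T,T,F,F,T,F,T,T,F,T,F,F,T,F],
    [F,T,F,F,T,F,T,T,F,F,T,F,T,F,F,T,T,F,F,T,F,T,F,F,T,T,F,T,F,F,T,F],
    [F,T,F,F,T,F,T,T,F,F,T,F,T,F,F,T,T,F,T,F,T,T,F,F,T,T,F,T,F,T,T,F,T],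
    [F,T,F,F,T,F,T,T,F,T,F,F,T,T,F,T,F,T,T,F,F,T,F,T,F,F,T,T,F,T,F,F,T,F],
    [F,T,F,F,T,F,T,T,F,F,T,F,T,F,F,T,T,F,T,F,F,T,F,F,T,T,F,T,T,F,T,F,F,T,F],
    [F,T,F,F,T,F,T,T,F,F,T,F,T,F,F,T,T,F,T,F,F,T,F,T,F,F,T,T,F,F,T,F,T,F,F,T],
    [F,T,F,F,T,F,T,T,F,F,T,F,T,F,F,T,T,F,T,F,F,T,F,T,F,F,T,T,F,F,T,F,T,F,F,T,F],
    [F,T,F,F,T,F,T,T,F,F,T,F,T,F,F,T,T,F,F,T,F,T,F,F,T,F,F,T,T,F,T,T,F,T,F,F,T,F],
    [F,T,F,F,T,F,T,T,F,F,T,F,T,F,F,T,T,F,F,T,F,T,F,F,T,F,T,F,F,T,T,F,F,T,F,T,F,F,T],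
    [F,T,F,F,T,F,T,T,F,F,T,F,T,F,F,T,T,F,F,T,F,T,F,F,T,F,T,F,F,T,T,F,F,T,F,T,F,F,T,F],
    [F,T,F,F,T,F,T,T,F,F,T,F,T,F,F,T,T,F,F,T,F,T,F,F,T,T,F,T,F,T,T,F,F,T,T,F,T,F,T,T,F],
    [F,T,F,F,T,F,T,T,F,F,T,F,T,F,F,T,T,F,F,T,F,T,F,F,T,T,F,T,F,T,T,F,F,T,T,F,T,F,T,T,F,T],
    [F,T,F,F,T,F,T,T,F,F,T,F,T,F,F,T,T,F,F,T,F,T,F,F,T,T,F,T,F,T,T,F,F,T,F,T,T,F,T,F,F,T,F],
    [F,T,F,F,T,F,T,T,F,F,T,F,T,F,F,T,T,F,F,T,F,T,F,F,T,T,F,T,F,F,T,F,F,T,T,F,T,T,F,T,F,F,T,F],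
    [F,T,F,F,T,F,T,T,F,F,T,F,T,F,F,T,T,F,F,T,F,T,F,F,T,T,F,T,F,F,T,F,T,F,F,T,T,F,F,T,F,T,F,F,T],
    [F,T,F,F,T,F,T,T,F,F,T,F,T,F,F,T,T,F,F,T,F,T,F,F,T,F,T,F,F,T,T,F,F,T,F,T,F,F,T,T,F,T,F,F,T,F],
    [F,T,F,F,T,F,T,T,F,F,T,F,T,F,F,T,T,F,F,T,F,T,F,F,T,F,F,T,T,F,T,T,F,T,F,T,T,F,F,T,T,F,T,F,T,T,F],
    [F,T,F,F,T,F,T,T,F,F,T,F,T,F,F,T,T,F,F,T,F,T,F,F,T,F,F,T,T,F,T,T,F,T,F,T,T,F,F,T,T,F,T,F,T,T,F,T],
    [F,T,F,F,T,F,T,T,F,F,T,F,T,F,F,T,T,F,F,T,F,T,F,F,T,T,F,T,F,T,T,F,F,T,F,T,F,F,T,T,F,F,T,F,T,F,F,T,F]]"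

section \<open>Local checks for short cubes and misplaced markers\<close>

text \<open>The argument \<open>k\<close> is the distance to the next position congruent to 27 modulo 28; only there
  \<open>marker\<close> may occur. Periods greater than 17 are left to the marker: two such periods have at
  least 36 = 28 + 9 - 1 letters.\<close>

fun scan :: "nat \<Rightarrow> word \<Rightarrow> bool" where
  "scan k [] = True"
| "scan 0 (x # w) = (\<not> starts_cube 17 (x # w) \<and> scan 27 w)"
| "scan (Suc k) (x # w) =
    (\<not> starts_cube 17 (x # w) \<and> \<not> agree 9 marker (x # w) \<and> scan k w)"

definition scan_ok :: "bool \<Rightarrow> word \<Rightarrow> bool" where
  "scan_ok f w \<longleftrightarrow> \<not> starts_cube 17 w \<and> (f \<or> \<not> agree 9 marker w)"

lemma scan_iff: "k < 28 \<Longrightarrow> scan k w \<longleftrightarrow> (\<forall>i<length w. scan_ok (i mod 28 = k) (drop i w))"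
proof (induction k w rule: scan.induct)
  case (2 x w)
  have "Suc i mod 28 = 0 \<longleftrightarrow> i mod 28 = 27" for i :: nat by (simp add: mod_Suc)
  then show ?case using 2 by (simp add: All_less_Suc2 scan_ok_def)
next
  case (3 k x w)
  then have "Suc i mod 28 = Suc k \<longleftrightarrow> i mod 28 = k" for i :: nat by (simp add: mod_Suc)
  then show ?case using 3 by (simp add: All_less_Suc2 scan_ok_def)
qed simp

lemma scan_okD: "scan 27 w \<Longrightarrow> i < length w \<Longrightarrow> scan_ok (i mod 28 = 27) (drop i w)"
  using scan_iff[of 27 w] by simp

lemma starts_cube_take: "starts_cube c (w @ z) \<Longrightarrow> 3 * c \<le> length w \<Longrightarrow> starts_cube c w"
  unfolding starts_cube_iff by (meson cube_prefix_take le_trans mult_le_mono2)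

text \<open>Since 51 = 3 * 17, any cube of period at most 17 at the head, and any marker there,
  already shows in \<open>w\<close>.\<close>

lemma scan_ok_append: "scan_ok f w \<Longrightarrow> 51 \<le> length w \<Longrightarrow> scan_ok f (w @ z)"
  unfolding scan_ok_def using starts_cube_take[of 17 w z] by (auto simp: agree_iff)

text \<open>Positions in \<open>x\<close> see at least 51 letters inside \<open>x @ y\<close>; the
  others lie in \<open>y @ z\<close>, and the shift by 28 preserves their residues.\<close>

lemma scan_glue:
  assumes "length x = 28" "51 \<le> length y" "scan 27 (x @ y)" "scan 27 (y @ z)"
  shows "scan 27 (x @ y @ z)"
proof -
  have "scan_ok (i mod 28 = 27) (drop i (x @ y @ z))" if i: "i < length (x @ y @ z)" for i
  proof (cases "i < 28")
    case True
    have "scan_ok (i mod 28 = 27) (drop i (x @ y))"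
      using True assms(1) by (intro scan_okD[OF assms(3)]) simp
    then have "scan_ok (i mod 28 = 27) (drop i (x @ y) @ z)"
      using True assms by (intro scan_ok_append) auto
    then show ?thesis using True assms(1) by simp
  next
    case False
    define j where "j = i - 28"
    have ij: "i = 28 + j" using False j_def by simp
    then have "scan_ok (j mod 28 = 27) (drop j (y @ z))"
      using assms(1) i by (intro scan_okD[OF assms(4)]) simp
    then show ?thesis unfolding ij using assms(1) by simp
  qed
  then show ?thesis by (simp add: scan_iff)
qed

lemma scan_append: "length x = 28 \<Longrightarrow> scan 27 (x @ y) \<Longrightarrow> scan 27 y"
proof -
  assume x: "length x = 28" and "scan 27 (x @ y)"
  then have "scan_ok ((28 + i) mod 28 = 27) (drop (28 + i) (x @ y))" if "i < length y" for i
    using that by (intro scan_okD) simp_all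
  then show "scan 27 y" using x by (simp add: scan_iff)
qed

text \<open>The six triples are the cubefree words of length 3.\<close>

lemma scan_blocks:
  "list_all (\<lambda>(a, b, c). scan 27 (block a @ block b @ block c))
    [(F,F,T), (F,T,F), (F,T,T), (T,F,F), (T,F,T), (T,T,F)]"
  by code_simp

lemma scan_tails:
  "list_all (\<lambda>w. list_all (\<lambda>(a, b). scan 27 (block a @ block b @ w))
    [(F,F), (F,T), (T,F), (T,T)]) tails"
  by code_simp

lemma tails_start: "list_all (\<lambda>w. take 8 w = head) tails"
  by code_simp

lemma check_rigid_tails: "list_all (check_rigid 5 []) tails"
  by code_simp

text \<open>Whatever follows a block starts with \<open>head\<close>, so these six letters may be
  assumed. Cubes of period at most 5 suffice as witnesses.\<close>

lemma check_rigid_blocks: "list_all (\<lambda>c. check_rigid 5 [] (block c @ take 6 head)) [F, T]"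
  by code_simp

text \<open>One tail for each residue modulo the block length 28.\<close>

lemma length_tails: "map length tails = [22..<50]"
  by code_simp

lemma length_block: "length (block c) = 28"
  by (simp add: block_def)

lemma length_morphism: "length (morphism v) = 28 * length v"
  by (induction v) (auto simp: morphism_def length_block)

lemma morphism_simps: "morphism [] = []" "morphism (c # v) = block c @ morphism v"
  by (simp_all add: morphism_def)

lemma drop_morphism:
  "t \<le> length v \<Longrightarrow> drop (28 * t) (morphism v @ w) = morphism (drop t v) @ w"
proof (induction t arbitrary: v)
  case (Suc t)
  then obtain c v' where v: "v = c # v'" by (cases v) auto
  have "28 * Suc t = 28 * t + 28" by simp
  then have "drop (28 * Suc t) (morphism v @ w) = drop (28 * t) (morphism v' @ w)"
    unfolding v morphism_simps by (simp add: length_block flip: drop_drop)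
  then show ?case using Suc v by simp
qed simp

lemma block_start: "block c = head @ drop 8 (block c)"
  by (simp add: block_def head_def)

text \<open>Blocks are prepended one at a time by \<open>scan_glue\<close>, with two blocks, 56
  letters, as overlap. At most two blocks are handled by cutting blocks off
  \<open>scan_tails\<close>.\<close>

lemma scan_morphism:
  assumes w: "w \<in> set tails" and v: "cubefree v"
  shows "scan 27 (morphism v @ w)"
  using v
proof (induction "length v" arbitrary: v rule: less_induct)
  case less
  have tail: "scan 27 (block a @ block b @ w)" for a b
    using scan_tails w by (cases a; cases b) (auto simp: list_all_iff)
  consider "v = []" | a where "v = [a]" | a b where "v = [a, b]" | a b c v' where "v = a # b # c # v'"
    by (metis neq_Nil_conv)
  then show ?case
  proof cases
    case 1
    then show ?thesis using scan_append[OF length_block scan_append[OF length_block tail]]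
      by (simp add: morphism_simps)
  next
    case 2
    then show ?thesis using scan_append[OF length_block tail] by (simp add: morphism_simps)
  next
    case 3
    then show ?thesis using tail by (simp add: morphism_simps)
  next
    case 4
    have "\<not> (a = b \<and> b = c)"
    proof
      assume "a = b \<and> b = c"
      then have "starts_cube (Suc 0) v" by (simp add: 4 starts_cube_def)
      with less.prems show False using not_cubefree_if_starts_cube[of _ v "[]"] by auto
    qed
    then have "scan 27 (block a @ block b @ block c)"
      using scan_blocks by (cases a; cases b; cases c) auto
    moreover have "scan 27 ((block b @ block c) @ morphism v' @ w)"
      using less.hyps[of "b # c # v'"] less.prems cubefree_append(2)[of "[a]" "b # c # v'"]
      by (simp add: 4 morphism_simps)
    ultimately have "scan 27 (block a @ (block b @ block c) @ morphism v' @ w)"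
      using scan_glue[of "block a" "block b @ block c" "morphism v' @ w"] by (simp add: length_block)
    then show ?thesis by (simp add: 4 morphism_simps)
  qed
qed

lemma morphism_start:
  assumes "w \<in> set tails"
  obtains z where "morphism v @ w = head @ z"
proof (cases v)
  case Nil
  have "take 8 w = head" using tails_start assms by (auto simp: list_all_iff)
  then show ?thesis using that Nil by (metis append_take_drop_id morphism_simps(1) append_Nil)
next
  case (Cons c v')
  then show ?thesis using that block_start by (metis append.assoc morphism_simps(2))
qed

lemma length_tails_bounds: "w \<in> set tails \<Longrightarrow> 22 \<le> length w \<and> length w \<le> 49"
proof -
  assume "w \<in> set tails"
  then have "length w \<in> set (map length tails)" by simp
  then show ?thesis unfolding length_tails set_upt atLeastLessThan_iff by simp
qed

text \<open>Sampling at 24 modulo 28 yields \<open>v\<close> and possibly \<open>w ! 24\<close>; as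
  tails have at most 49 letters, they are sampled at most once.\<close>

lemma cubefree_morphism:
  assumes w: "w \<in> set tails"
    and cf: "cubefree (v @ (if 24 < length w then [w ! 24] else []))"
  shows "cubefree (morphism v @ w)"
proof (rule cubefree_by_decimation[where q = 28 and d = 24 and r = 27 and c = 17 and m = marker])
  let ?W = "morphism v @ w" and ?V = "v @ (if 24 < length w then [w ! 24] else [])"
  note lw = length_tails_bounds[OF w]
  note ok = scan_okD[OF scan_morphism[OF w cubefree_append(1)[OF cf]]]
  have lm: "length marker = 9" by (simp add: marker_def)
  show "\<not> starts_cube 17 (drop i ?W)" for i
    using ok[of i] by (cases "i < length ?W") (auto simp: scan_ok_def starts_cube_def)
  show "i mod 28 = 27" if "agree (length marker) marker (drop i ?W)" for i
  proof (cases "i < length ?W")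
    case True
    then show ?thesis using ok[OF True] that unfolding scan_ok_def lm by blast
  next
    case False
    then show ?thesis using that by (simp add: agree_iff lm)
  qed
  have split: "drop (28 * t) ?W = block (v ! t) @ morphism (drop (Suc t) v) @ w" if "t < length v" for t
    using that drop_morphism[of t v w] by (simp add: morphism_simps flip: Cons_nth_drop_Suc)
  show "\<exists>j\<ge>i. j + length marker \<le> i + 2 * p \<and> agree (length marker) marker (drop j ?W)"
    if p: "17 < p" "i + 3 * p \<le> length ?W" for i p
  proof (intro exI conjI)
    define t where "t = i div 28"
    have i: "28 * t \<le> i" "i < 28 * t + 28" unfolding t_def by auto
    \<comment> \<open>As 3 * 18 = 54 exceeds the length of any tail, the cube starts inside a block,
      and the marker at the end of this block serves as witness.\<close>
    have "i + 54 \<le> 28 * length v + 49" using p lw by (simp add: length_morphism)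
    then have t: "t < length v" using i by linarith
    show "i \<le> 28 * t + 27" using i by simp
    show "28 * t + 27 + length marker \<le> i + 2 * p" using i p by (simp add: marker_def)
    obtain z where z: "morphism (drop (Suc t) v) @ w = head @ z" using morphism_start[OF w] .
    have "drop (28 * t + 27) ?W = drop 27 (block (v ! t) @ head @ z)"
      using split[OF t] z by (metis add.commute drop_drop)
    then show "agree (length marker) marker (drop (28 * t + 27) ?W)"
      by (simp add: block_def head_def marker_def)
  qed
  show V: "t < length ?V \<longleftrightarrow> 28 * t + 24 < length ?W" for t
    using lw by (auto simp: length_morphism)
  show "?V ! t = ?W ! (28 * t + 24)" if "t < length ?V" for t
  proof (cases "t < length v")
    case True
    have "28 * t \<le> length ?W" using that V[of t] by linarith
    then have "?W ! (28 * t + 24) = drop (28 * t) ?W ! 24" by (rule nth_drop[symmetric])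
    also have "\<dots> = v ! t" unfolding split[OF True] by (simp add: block_def)
    finally show ?thesis using True by (simp add: nth_append)
  next
    case False
    then have "t = length v" "24 < length w" using that by (auto split: if_splits)
    then show ?thesis by (simp add: nth_append length_morphism)
  qed
qed (use cf in auto)

lemma rigid_morphism:
  assumes w: "w \<in> set tails"
  shows "rigid (morphism v @ w)"
proof (induction v)
  case Nil
  then show ?case using check_rigid_tails w
    by (auto simp: list_all_iff morphism_simps intro: rigid_if_check_rigid)
next
  case (Cons c v)
  obtain z where z: "morphism v @ w = head @ z" using morphism_start[OF w] .
  have "rigid (block c @ take 6 head)"
    using check_rigid_blocks by (cases c) (auto intro: rigid_if_check_rigid)
  moreover have "morphism v @ w = take 6 head @ drop 6 head @ z"
    unfolding z append_assoc[symmetric] append_take_drop_id ..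
  ultimately show ?case
    using Cons rigid_glue[of "block c" "take 6 head" "drop 6 head @ z"]
    by (simp add: morphism_simps head_def)
qed

lemma ex_tail:
  assumes "22 \<le> n" "n < 50"
  obtains w where "w \<in> set tails" "length w = n"
proof -
  have "n \<in> set (map length tails)" 
    unfolding length_tails set_upt atLeastLessThan_iff using assms by blast
  then show ?thesis using that by auto
qed

text \<open>The tail of length 22 contains no sampled letter, so \<open>morphism v @ w\<close> is
  cubefree with \<open>v\<close>, and a prefix of it is one letter longer than
  \<open>v\<close>.\<close>

lemma ex_cubefree: "\<exists>v. length v = n \<and> cubefree v"
proof (induction n)
  case 0
  then show ?case by (simp add: cubefree_def cube_def)
next
  case (Suc n)
  then obtain v where v: "length v = n" "cubefree v" by blast
  obtain w where w: "w \<in> set tails" "length w = 22" by (rule ex_tail[of 22]) auto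
  have cf: "cubefree (morphism v @ w)" using cubefree_morphism w v by simp
  then have "cubefree (take (Suc n) (morphism v @ w))"
    using cubefree_append(1) by (metis append_take_drop_id)
  moreover have "length (take (Suc n) (morphism v @ w)) = Suc n"
    using w v by (simp add: length_morphism)
  ultimately show ?case by blast
qed

text \<open>Complementing all letters preserves cubefreeness and adjusts the last letter.\<close>

lemma ex_cubefree_snoc: "\<exists>v. length v = n \<and> cubefree (v @ [c])"
proof -
  obtain u where u: "length u = Suc n" "cubefree u" using ex_cubefree by blast
  then obtain v x where v: "u = v @ [x]" by (metis length_Suc_conv_rev)
  then have "cubefree (v @ [x])" "cubefree (map Not v @ [\<not> x])"
    using u cubefree_map_Not[of u] by auto
  moreover have "length v = n" using u v by simp
  moreover have "x = c \<or> c = (\<not> x)" by auto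
  ultimately show ?thesis
    by (elim disjE) (auto intro: exI[of _ v] exI[of _ "map Not v"])
qed

lemma ex_irreducible_ge_22:
  assumes "22 \<le> n"
  shows "\<exists>w. irreducible_cubefree w \<and> length w = n"
proof -
  define k where "k = (n - 22) div 28"
  have k: "n - 28 * k < 50" "22 \<le> n - 28 * k" "28 * k \<le> n"
  proof -
    have "n - 22 = 28 * k + (n - 22) mod 28" "(n - 22) mod 28 < 28" unfolding k_def by simp_all
    then show "n - 28 * k < 50" "22 \<le> n - 28 * k" "28 * k \<le> n" using assms by linarith+
  qed
  then obtain w where w: "w \<in> set tails" "length w = n - 28 * k" by (metis ex_tail)
  \<comment> \<open>If \<open>w\<close> has at most 24 letters, the extra letter is arbitrary and is
    dropped again by \<open>cubefree_append\<close>.\<close>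
  obtain v where v: "length v = k" "cubefree (v @ [w ! 24])" using ex_cubefree_snoc by blast
  have "cubefree (morphism v @ w)"
    using cubefree_morphism[OF w(1)] v cubefree_append(1) by auto
  then have "irreducible_cubefree (morphism v @ w)"
    using rigid_morphism[OF w(1)] k w by (auto simp: irreducible_cubefree_iff)
  moreover have "length (morphism v @ w) = n" using v w k by (simp add: length_morphism)
  ultimately show ?thesis by blast
qed

definition short_words :: "word list" where
  "short_words = [
    [F,T,F,F,T,F,T,T,F,T],
    [F,T,F,F,T,F,T,T,F,T,F,F,T,F],
    [F,T,F,F,T,F,T,T,F,T,F,F,T,F,T,T,F,T],
    [F,T,F,F,T,F,T,F,F,T,T,F,F,T,F,T,F,F,T],
    [F,T,F,F,T,F,T,F,F,T,T,F,F,T,F,T,F,F,T,F]]"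

text \<open>Words of at most 20 letters have no cubes of period above 6.\<close>

lemma check_short_words:
  "list_all (\<lambda>w. check_cubefree 6 w \<and> check_rigid 5 [] w) short_words"
  by code_simp

lemma ex_irreducible_short:
  assumes "n \<in> {10, 14, 18, 19, 20}"
  shows "\<exists>w. irreducible_cubefree w \<and> length w = n"
proof -
  have len: "map length short_words = [10, 14, 18, 19, 20]" by (simp add: short_words_def)
  have "n \<in> set (map length short_words)" unfolding len using assms by simp
  then obtain w where w: "w \<in> set short_words" "length w = n" by auto
  then have "check_cubefree 6 w" "rigid w"
    using check_short_words by (auto simp: list_all_iff intro: rigid_if_check_rigid)
  moreover have "3 \<le> length w" "length w < 21" using w assms by auto
  ultimately show ?thesis using w cubefree_if_check_cubefree[of 6 w]
    by (auto simp: irreducible_cubefree_iff)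
qed

theorem theorem2:
  fixes n :: nat
  shows "(\<exists>w. irreducible_cubefree w \<and> length w = n) \<longleftrightarrow>
         n \<in> {10, 14, 18, 19, 20} \<union> {m. 22 \<le> m}"
proof
  assume "\<exists>w. irreducible_cubefree w \<and> length w = n"
  then obtain w where w: "irreducible_cubefree w" "length w = n" by blast
  then have "3 \<le> n" "n \<notin> {3, 4, 5, 6, 7, 8, 9, 11, 12, 13, 15, 16, 17, 21}"
    using no_irreducible_cubefree[of w] by (auto simp: irreducible_cubefree_def)
  then show "n \<in> {10, 14, 18, 19, 20} \<union> {m. 22 \<le> m}"
    by simp presburger
next
  assume "n \<in> {10, 14, 18, 19, 20} \<union> {m. 22 \<le> m}"
  then show "\<exists>w. irreducible_cubefree w \<and> length w = n"
    using ex_irreducible_short ex_irreducible_ge_22 by blast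
qed

end
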